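(* Let $K$ be an imaginary quadratic field of discriminant $\Delta\le-15$, and let $\mathcal{A}^0_K$ be the subgroup of $\mathrm{PGL}_2(\mathbb{C})$ (acting on $\widehat{\mathbb{C}}$ by Möbius transformations) generated by $$\gamma_1=\begin{pmatrix}-1&2\\-1&1\end{pmatrix},\quad \gamma_2=\begin{pmatrix}1&-1\\2&-1\end{pmatrix},\quad \gamma_3=\begin{pmatrix}0&1\\-1&0\end{pmatrix},\quad r=\begin{pmatrix}1&1-\tau\\0&-1\end{pmatrix}.$$ Then $\mathcal{A}^0_K$ has the presentation $$\langle s_1,s_2,s_3,r : s_1^2=s_2^2=s_3^2=r^2=1,\ r s_1s_2s_3=s_3s_2s_1 r\rangle,$$ realised by $s_i\mapsto\gamma_i$ ($i=1,2,3$) and $r\mapsto r$.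
   Context: $\tau\in\mathcal{O}_K$ is defined by $\tau=\sqrt{\Delta}/2$ if $\Delta\equiv0\pmod 4$ and $\tau=(1+\sqrt{\Delta})/2$ if $\Delta\equiv1\pmod4$, so that $\mathcal{O}_K=\mathbb{Z}+\tau\mathbb{Z}$. *)

theory Defs
  imports "HOL-Analysis.Analysis" "HOL-Algebra.Algebraic_Closure_Type"
    "HOL-Algebra.Elementary_Groups"
begin

section \<open>Free groups and presentations\<close>

text \<open>A word over an alphabet; the letter \<open>(x, True)\<close> stands for the generator \<open>x\<close> and
  \<open>(x, False)\<close> for its formal inverse.\<close>

type_synonym 'a word = "('a \<times> bool) list"

inductive cancel_pair :: "'a word \<Rightarrow> 'a word \<Rightarrow> bool" where
  "cancel_pair (u @ [(x, b), (x, \<not> b)] @ v) (u @ v)"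

definition word_class :: "'a word \<Rightarrow> 'a word set" where
  "word_class u = {v. equivclp cancel_pair u v}"

text \<open>The free group on the (whole) type \<open>'a\<close>: classes of words modulo insertion and deletion
  of cancelling pairs, multiplied by concatenation of representatives.\<close>

definition free_group :: "'a word set monoid" where
  "free_group = \<lparr> carrier = range word_class,
                  mult = (\<lambda>A B. \<Union>u\<in>A. \<Union>v\<in>B. word_class (u @ v)),
                  one = word_class [] \<rparr>"

definition normal_closure :: "('a, 'b) monoid_scheme \<Rightarrow> 'a set \<Rightarrow> 'a set" where
  "normal_closure G S = \<Inter>{N. N \<lhd> G \<and> S \<subseteq> N}"

text \<open>A relation \<open>u = v\<close> is given as the pair \<open>(u, v)\<close>; its relator is \<open>u v\<^sup>-\<^sup>1\<close>.\<close>

definition relators :: "('a word \<times> 'a word) set \<Rightarrow> 'a word set set" where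
  "relators rels =
     {word_class u \<otimes>\<^bsub>free_group\<^esub> inv\<^bsub>free_group\<^esub> (word_class v) |u v. (u, v) \<in> rels}"

definition presented_group :: "('a word \<times> 'a word) set \<Rightarrow> 'a word set set monoid" where
  "presented_group rels = free_group Mod normal_closure free_group (relators rels)"

definition presented_gen :: "('a word \<times> 'a word) set \<Rightarrow> 'a \<Rightarrow> 'a word set set" where
  "presented_gen rels x =
     normal_closure free_group (relators rels) #>\<^bsub>free_group\<^esub> word_class [(x, True)]"

lemma word_class_eq_iff: "word_class u = word_class v \<longleftrightarrow> equivclp cancel_pair u v"
proof
  assume h: "word_class u = word_class v"
  have "v \<in> word_class v" by (simp add: word_class_def)
  then show "equivclp cancel_pair u v" unfolding h[symmetric] by (simp add: word_class_def)
next
  assume h: "equivclp cancel_pair u v"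
  show "word_class u = word_class v" unfolding word_class_def
    using h equivclp_sym[OF h] by (blast intro: equivclp_trans)
qed

lemma cancel_pair_append:
  assumes "cancel_pair u v" shows "cancel_pair (p @ u @ q) (p @ v @ q)"
  using assms
proof cases
  case (1 a x b c)
  have "cancel_pair ((p @ a) @ [(x, b), (x, \<not> b)] @ (c @ q)) ((p @ a) @ (c @ q))"
    by (rule cancel_pair.intros)
  with 1 show ?thesis by simp
qed

lemma equivclp_cancel_pair_append:
  "equivclp cancel_pair u v \<Longrightarrow> equivclp cancel_pair (p @ u @ q) (p @ v @ q)"
proof (induction rule: equivclp_induct)
  case base
  then show ?case by simp
next
  case (step y z)
  then show ?case
    using cancel_pair_append[of y z p q] cancel_pair_append[of z y p q] by (blast intro: equivclp_into_equivclp)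
qed

lemma free_group_mult:
  "word_class u \<otimes>\<^bsub>free_group\<^esub> word_class v = word_class (u @ v)"
proof -
  have "word_class (u' @ v') = word_class (u @ v)"
    if "u' \<in> word_class u" "v' \<in> word_class v" for u' v'
  proof -
    have "equivclp cancel_pair u u'" "equivclp cancel_pair v v'"
      using that by (auto simp: word_class_def)
    then have "equivclp cancel_pair (u @ v) (u' @ v)" "equivclp cancel_pair (u' @ v) (u' @ v')"
      using equivclp_cancel_pair_append[of u u' "[]" v]
        equivclp_cancel_pair_append[of v v' u' "[]"] by auto
    then have "word_class (u @ v) = word_class (u' @ v)"
      "word_class (u' @ v) = word_class (u' @ v')"
      by (simp_all only: word_class_eq_iff)
    then show ?thesis by simp
  qed
  moreover have "u \<in> word_class u" "v \<in> word_class v" by (auto simp: word_class_def)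
  ultimately have "(\<Union>a\<in>word_class u. \<Union>b\<in>word_class v. word_class (a @ b)) = word_class (u @ v)" by blast
  then show ?thesis by (simp add: free_group_def)
qed

lemma free_group_inverse:
  "word_class (map (\<lambda>(x, b). (x, \<not> b)) (rev w) @ w) = word_class []"
proof (induction w)
  case (Cons a w)
  obtain x b where a: "a = (x, b)" by fastforce
  let ?i = "map (\<lambda>(x, b). (x, \<not> b)) (rev w)"
  have "cancel_pair (?i @ [(x, \<not> b), (x, \<not> \<not> b)] @ w) (?i @ w)"
    by (rule cancel_pair.intros)
  then have "equivclp cancel_pair (?i @ [(x, \<not> b), (x, b)] @ w) (?i @ w)"
    by auto
  then have "word_class (?i @ [(x, \<not> b), (x, b)] @ w) = word_class (?i @ w)" by (simp only: word_class_eq_iff)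
  with Cons show ?case by (simp add: a)
qed simp

lemma group_free_group: "group (free_group :: 'a word set monoid)"
proof (rule groupI)
  fix A assume "A \<in> carrier (free_group :: 'a word set monoid)"
  then obtain w where "A = word_class w" by (auto simp: free_group_def)
  then show "\<exists>B\<in>carrier free_group. B \<otimes>\<^bsub>free_group\<^esub> A = \<one>\<^bsub>free_group\<^esub>"
    using free_group_mult[of "map (\<lambda>(x, b). (x, \<not> b)) (rev w)" w] free_group_inverse[of w]
    by (auto simp: free_group_def)
next
  fix A assume "A \<in> carrier (free_group :: 'a word set monoid)"
  then show "\<one>\<^bsub>free_group\<^esub> \<otimes>\<^bsub>free_group\<^esub> A = A"
    using free_group_mult[of "[]"] by (auto simp: free_group_def)
next
  fix A B C assume "A \<in> carrier (free_group :: 'a word set monoid)"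
    "B \<in> carrier (free_group :: 'a word set monoid)"
    "C \<in> carrier (free_group :: 'a word set monoid)"
  then obtain u v w where "A = word_class u" "B = word_class v" "C = word_class w"
    by (auto simp: free_group_def)
  then show "A \<otimes>\<^bsub>free_group\<^esub> B \<otimes>\<^bsub>free_group\<^esub> C = A \<otimes>\<^bsub>free_group\<^esub> (B \<otimes>\<^bsub>free_group\<^esub> C)"
    by (simp add: free_group_mult)
next
  fix A B assume "A \<in> carrier (free_group :: 'a word set monoid)"
    "B \<in> carrier (free_group :: 'a word set monoid)"
  then obtain u v where "A = word_class u" "B = word_class v"
    by (auto simp: free_group_def)
  then show "A \<otimes>\<^bsub>free_group\<^esub> B \<in> carrier free_group"
    by (simp add: free_group_mult) (simp add: free_group_def)
qed (simp add: free_group_def)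

section \<open>The group \<open>PGL\<^sub>2(\<complex>)\<close>\<close>

definition GL2 :: "(complex^2^2) monoid" where
  "GL2 = \<lparr> carrier = {A. invertible A}, mult = (**), one = mat 1 \<rparr>"

definition scalars :: "(complex^2^2) set" where
  "scalars = {mat c |c. c \<noteq> 0}"

definition PGL2 :: "(complex^2^2) set monoid" where
  "PGL2 = GL2 Mod scalars"

definition pgl :: "complex \<Rightarrow> complex \<Rightarrow> complex \<Rightarrow> complex \<Rightarrow> (complex^2^2) set" where
  "pgl a b c d = scalars #>\<^bsub>GL2\<^esub> vector [vector [a, b], vector [c, d]]"

lemma group_GL2: "group GL2"
proof (rule groupI)
  fix A assume "A \<in> carrier GL2"
  then obtain B where "A ** B = mat 1" "B ** A = mat 1" by (auto simp: GL2_def invertible_def)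
  then show "\<exists>y\<in>carrier GL2. y \<otimes>\<^bsub>GL2\<^esub> A = \<one>\<^bsub>GL2\<^esub>" 
    by (intro bexI[of _ B]) (auto simp: GL2_def invertible_def)
next
  have "invertible (mat 1 :: complex^2^2)" by (auto simp: invertible_def)
  then show "\<one>\<^bsub>GL2\<^esub> \<in> carrier GL2" by (simp add: GL2_def)
qed (auto simp: GL2_def invertible_mult matrix_mul_assoc)

lemma mat_commute: "mat c ** (A::complex^2^2) = A ** mat c"
  by (simp add: vec_eq_iff matrix_matrix_mult_def mat_def sum_2 forall_2)
lemma mat_mult_mat: "mat c ** (mat d::complex^2^2) = mat (c*d)"
  by (simp add: vec_eq_iff matrix_matrix_mult_def mat_def sum_2 forall_2)

lemma subgroup_scalars: "subgroup scalars GL2"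
proof -
  interpret group GL2 by (rule group_GL2)
  show ?thesis
  proof (rule subgroupI)
    show "scalars \<subseteq> carrier GL2"
    proof
      fix x assume "x \<in> scalars"
      then obtain c where "x = mat c" "c \<noteq> 0" by (auto simp: scalars_def)
      then show "x \<in> carrier GL2" by (auto simp: GL2_def invertible_def mat_mult_mat intro!: exI[of _ "mat (1/c)"])
    qed
    show "scalars \<noteq> {}" by (auto simp: scalars_def intro: exI[of _ 1])
    fix x assume "x \<in> scalars"
    then obtain c where c: "x = mat c" "c \<noteq> 0" by (auto simp: scalars_def)
    have inv: "invertible (mat d :: complex^2^2)" if "d \<noteq> 0" for d
      using that by (auto simp: invertible_def mat_mult_mat intro!: exI[of _ "mat (1/d)"])
    have "inv\<^bsub>GL2\<^esub> x = mat (1/c)"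
      using c inv[of c] inv[of "1/c"]
      by (intro inv_equality) (auto simp: GL2_def mat_mult_mat)
    then show "inv\<^bsub>GL2\<^esub> x \<in> scalars" using c by (auto simp: scalars_def)
  next
    fix x y assume "x \<in> scalars" "y \<in> scalars"
    then show "x \<otimes>\<^bsub>GL2\<^esub> y \<in> scalars" by (auto simp: scalars_def GL2_def mat_mult_mat)
  qed
qed

lemma normal_scalars: "scalars \<lhd> GL2"
proof -
  interpret group GL2 by (rule group_GL2)
  have "scalars #>\<^bsub>GL2\<^esub> x = x <#\<^bsub>GL2\<^esub> scalars" for x
    by (auto simp: r_coset_def l_coset_def GL2_def scalars_def mat_commute)
  then show ?thesis using subgroup_scalars by (intro normalI) auto
qed

section \<open>Imaginary quadratic fields\<close>

text \<open>Number fields are taken as subfields of \<open>\<complex>\<close>.\<close>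

definition imaginary_quadratic_field :: "complex set \<Rightarrow> bool" where
  "imaginary_quadratic_field K \<longleftrightarrow>
     subfield K ring_of_type_algebra \<and> ring.dimension ring_of_type_algebra 2 \<rat> K \<and>
     \<not> K \<subseteq> \<real>"

definition ring_of_integers :: "complex set \<Rightarrow> complex set" where
  "ring_of_integers K = {x \<in> K. algebraic_int x}"

text \<open>For an integral basis \<open>a, b\<close> the discriminant is the squared determinant with rows
  \<open>(a, b)\<close> and \<open>(\<sigma> a, \<sigma> b)\<close>, where the nontrivial automorphism \<open>\<sigma>\<close> of an imaginary quadratic
  field is complex conjugation. Two elements spanning the ring of integers (which has rank 2) are
  automatically a basis.\<close>

definition has_discriminant :: "complex set \<Rightarrow> int \<Rightarrow> bool" where
  "has_discriminant K D \<longleftrightarrow>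
     (\<exists>a b. ring_of_integers K = {of_int m * a + of_int n * b |m n. True} \<and>
            (a * cnj b - b * cnj a)\<^sup>2 = of_int D)"

text \<open>For negative \<open>D\<close> the principal root \<^term>\<open>csqrt (of_int D)\<close> is \<open>\<i> * sqrt \<bar>D\<bar>\<close>.
  A discriminant is 0 or 1 modulo 4, so the second branch is the case 1 modulo 4.\<close>

definition tau :: "int \<Rightarrow> complex" where
  "tau D = (if D mod 4 = 0 then csqrt (of_int D) / 2 else (1 + csqrt (of_int D)) / 2)"

section \<open>The group and its presentation\<close>

datatype letter = S1 | S2 | S3 | Sr

fun gen_image :: "int \<Rightarrow> letter \<Rightarrow> (complex^2^2) set" where
  "gen_image D S1 = pgl (-1) 2 (-1) 1"
| "gen_image D S2 = pgl 1 (-1) 2 (-1)"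
| "gen_image D S3 = pgl 0 1 (-1) 0"
| "gen_image D Sr = pgl 1 (1 - tau D) 0 (-1)"

definition A0 :: "int \<Rightarrow> (complex^2^2) set monoid" where
  "A0 D = subgroup_generated PGL2 {gen_image D S1, gen_image D S2, gen_image D S3, gen_image D Sr}"

definition A0_relations :: "(letter word \<times> letter word) set" where
  "A0_relations =
     {([(S1, True), (S1, True)], []),
      ([(S2, True), (S2, True)], []),
      ([(S3, True), (S3, True)], []),
      ([(Sr, True), (Sr, True)], []),
      ([(Sr, True), (S1, True), (S2, True), (S3, True)],
       [(S3, True), (S2, True), (S1, True), (Sr, True)])}"

end

theory Submission
  imports Defs
begin

text \<open>The presented group is the amalgam of \<open>C\<^sub>2 * C\<^sub>2 * C\<^sub>2\<close> and the infinite dihedral group over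
  \<open>\<langle>s\<^sub>1s\<^sub>2s\<^sub>3\<rangle>\<close>, where \<open>\<gamma>\<^sub>1\<gamma>\<^sub>2\<gamma>\<^sub>3\<close> is the translation by 3 and \<open>r\<close> is the half-turn
  \<open>z \<mapsto> \<tau> - 1 - z\<close>. Faithfulness is shown by playing ping-pong twice. The \<open>\<gamma>\<^sub>i\<close> are the
  half-turns about the sides of an ideal triangle, so reduced words in them act nontrivially.
  An element of \<open>\<langle>\<gamma>\<^sub>1, \<gamma>\<^sub>2, \<gamma>\<^sub>3\<rangle> \<subseteq> PSL\<^sub>2(\<int>)\<close> that is not a translation maps the part of the
  upper half-plane outside the closed unit discs centred at integers into the union of the open
  discs; \<open>r\<close> maps that union, and the lower half-plane, back outside, because the integers and
  \<open>\<tau> + \<int>\<close> are at distance at least 2 when \<open>\<Delta> \<le> -15\<close>. Hence a word that contains \<open>r\<close>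
  and acts trivially has a subword \<open>r g r\<close> with \<open>g\<close> a translation in \<open>\<langle>\<gamma>\<^sub>1, \<gamma>\<^sub>2, \<gamma>\<^sub>3\<rangle>\<close>. A
  congruence modulo 3 puts \<open>g\<close> into \<open>\<langle>\<gamma>\<^sub>1\<gamma>\<^sub>2\<gamma>\<^sub>3\<rangle>\<close>, so that the relations replace \<open>r g r\<close>
  by \<open>g\<^sup>-\<^sup>1\<close>.\<close>

unbundle no fps_syntax

section \<open>Homomorphisms out of presented groups\<close>

text \<open>The homomorphism from the free group extending \<open>f\<close>, kept on words so that
  it computes by recursion; \<open>word_eval_word_class_cong\<close> lets it descend to
  classes.\<close>

definition word_eval :: "('g, 'm) monoid_scheme \<Rightarrow> ('a \<Rightarrow> 'g) \<Rightarrow> 'a word \<Rightarrow> 'g" where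
  "word_eval G f w =
     foldr (\<lambda>(x, b) y. (if b then f x else inv\<^bsub>G\<^esub> f x) \<otimes>\<^bsub>G\<^esub> y) w \<one>\<^bsub>G\<^esub>"

lemma word_eval_Nil [simp]: "word_eval G f [] = \<one>\<^bsub>G\<^esub>"
  and word_eval_Cons [simp]:
    "word_eval G f ((x, b) # w) = (if b then f x else inv\<^bsub>G\<^esub> f x) \<otimes>\<^bsub>G\<^esub> word_eval G f w"
  by (simp_all add: word_eval_def)

context group
begin

lemma word_eval_closed [simp]: "range f \<subseteq> carrier G \<Longrightarrow> word_eval G f w \<in> carrier G"
  by (induction w) (auto simp: image_subset_iff)

lemma word_eval_append:
  "range f \<subseteq> carrier G \<Longrightarrow> word_eval G f (u @ v) = word_eval G f u \<otimes> word_eval G f v"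
proof (induction u)
  case (Cons a u)
  have "f x \<in> carrier G" for x using Cons.prems by auto
  with Cons show ?case by (cases a) (simp add: m_assoc)
qed simp

lemma word_eval_cancel_pair:
  assumes "range f \<subseteq> carrier G" "cancel_pair u v"
  shows "word_eval G f u = word_eval G f v"
  using assms(2)
proof cases
  case (1 p x b q)
  have "f x \<in> carrier G" using assms(1) by auto
  then have "word_eval G f [(x, b), (x, \<not> b)] = \<one>" by simp
  then show ?thesis using assms(1) unfolding 1 by (simp only: word_eval_append) simp
qed

lemma word_eval_word_class_cong:
  assumes "range f \<subseteq> carrier G" "word_class u = word_class v"
  shows "word_eval G f u = word_eval G f v"
proof -
  have "equivclp cancel_pair u v" using assms(2) by (simp add: word_class_eq_iff)
  then show ?thesis
    by (induction rule: equivclp_induct) (use word_eval_cancel_pair[OF assms(1)] in fastforce)+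
qed

lemma word_eval_generate:
  assumes "range f \<subseteq> carrier G"
  shows "range (word_eval G f) = generate G (range f)"
proof
  show "range (word_eval G f) \<subseteq> generate G (range f)"
  proof clarify
    fix w show "word_eval G f w \<in> generate G (range f)"
    proof (induction w)
      case (Cons a w)
      then show ?case by (cases a) (auto intro: generate.intros)
    qed (simp add: generate.one)
  qed
next
  show "generate G (range f) \<subseteq> range (word_eval G f)"
  proof
    fix g assume "g \<in> generate G (range f)"
    then show "g \<in> range (word_eval G f)"
    proof induction
      case one
      show ?case using word_eval_Nil[of G f] by (metis rangeI)
    next
      case (incl h)
      then obtain x where "h = f x" "h \<in> carrier G" using assms by auto
      then have "h = word_eval G f [(x, True)]" by simp
      then show ?case by blast
    next
      case (inv h)
      then obtain x where "h = f x" "h \<in> carrier G" using assms by auto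
      then have "inv h = word_eval G f [(x, False)]" by simp
      then show ?case by blast
    next
      case (eng g h)
      then obtain u v where "g = word_eval G f u" "h = word_eval G f v" by blast
      then have "g \<otimes> h = word_eval G f (u @ v)" by (simp add: word_eval_append[OF assms])
      then show ?case by blast
    qed
  qed
qed

lemma normal_closure_normal:
  assumes "S \<subseteq> carrier G"
  shows "normal_closure G S \<lhd> G" "S \<subseteq> normal_closure G S"
proof -
  \<comment> \<open>This witnesses that the family being intersected is nonempty.\<close>
  have "carrier G \<lhd> G" by (simp add: normal_inv_iff subgroup_self)
  then have ne: "{N. N \<lhd> G \<and> S \<subseteq> N} \<noteq> {}" using assms by auto
  have "subgroup (normal_closure G S) G"
    unfolding normal_closure_def by (rule subgroups_Inter) (use ne normal_imp_subgroup in auto)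
  then show "normal_closure G S \<lhd> G"
  proof (rule normal_invI)
    fix x h assume "x \<in> carrier G" "h \<in> normal_closure G S"
    then show "x \<otimes> h \<otimes> inv x \<in> normal_closure G S"
      by (auto simp: normal_closure_def intro: normal.inv_op_closed2)
  qed
  show "S \<subseteq> normal_closure G S" by (auto simp: normal_closure_def)
qed

end

lemma word_class_in_carrier [simp]: "word_class w \<in> carrier free_group"
  by (simp add: free_group_def)

lemma word_class_exists:
  assumes "A \<in> carrier free_group"
  obtains w where "A = word_class w"
  using assms by (auto simp: free_group_def)

lemma relators_subset: "relators rels \<subseteq> carrier free_group"
proof -
  interpret F: group free_group by (rule group_free_group)
  show ?thesis by (auto simp: relators_def)
qed

lemma one_free_group: "\<one>\<^bsub>free_group\<^esub> = word_class []"
  by (simp add: free_group_def)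

lemma normal_closure_relators_normal:
  "normal_closure free_group (relators rels) \<lhd> free_group"
  by (rule group.normal_closure_normal(1)[OF group_free_group relators_subset])

lemma group_presented_group: "group (presented_group rels)"
  unfolding presented_group_def
  by (rule normal.factorgroup_is_group[OF normal_closure_relators_normal])

lemma presented_gen_closed: "range (presented_gen rels) \<subseteq> carrier (presented_group rels)"
  using word_class_in_carrier by (fastforce simp: presented_gen_def presented_group_def FactGroup_def RCOSETS_def)

text \<open>Passing to cosets is multiplicative and takes formal inverses to inverses, so it obeys
  the recursion of \<open>word_eval\<close>. Triviality in the presented group thus becomes
  membership in the normal closure.\<close>

lemma word_eval_presented_gen:
  "word_eval (presented_group rels) (presented_gen rels) w =
     normal_closure free_group (relators rels) #>\<^bsub>free_group\<^esub> word_class w"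
proof -
  interpret F: group free_group by (rule group_free_group)
  interpret N: normal "normal_closure free_group (relators rels)" free_group
    by (rule normal_closure_relators_normal)
  interpret P: group "presented_group rels" by (rule group_presented_group)
  let ?c = "\<lambda>w. normal_closure free_group (relators rels) #>\<^bsub>free_group\<^esub> word_class w"
  have mult: "?c u \<otimes>\<^bsub>presented_group rels\<^esub> ?c v = ?c (u @ v)" for u v
    by (simp add: presented_group_def FactGroup_def N.rcos_sum free_group_mult)
  have one: "?c [] = \<one>\<^bsub>presented_group rels\<^esub>"
    by (simp add: presented_group_def FactGroup_def N.subset flip: one_free_group)
  have closed: "?c w \<in> carrier (presented_group rels)" for w
    by (auto simp: presented_group_def FactGroup_def RCOSETS_def)
  have inv: "inv\<^bsub>presented_group rels\<^esub> ?c [(x, True)] = ?c [(x, False)]" for x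
  proof (rule P.inv_equality)
    have "word_class [(x, False), (x, True)] = word_class []"
      using free_group_inverse[of "[(x, True)]"] by simp
    then show "?c [(x, False)] \<otimes>\<^bsub>presented_group rels\<^esub> ?c [(x, True)] = \<one>\<^bsub>presented_group rels\<^esub>"
      by (simp add: mult one)
  qed (rule closed)+
  have gen: "presented_gen rels x = ?c [(x, True)]" for x
    by (simp add: presented_gen_def)
  show ?thesis
  proof (induction w)
    case Nil
    then show ?case by (simp add: one)
  next
    case (Cons a w)
    then show ?case by (cases a) (simp add: gen inv mult)
  qed
qed

lemma presented_gen_relation:
  assumes "(u, v) \<in> rels"
  shows "word_eval (presented_group rels) (presented_gen rels) u =
         word_eval (presented_group rels) (presented_gen rels) v"
proof -
  interpret F: group free_group by (rule group_free_group)
  interpret N: normal "normal_closure free_group (relators rels)" free_group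
    by (rule normal_closure_relators_normal)
  have "word_class u \<otimes>\<^bsub>free_group\<^esub> inv\<^bsub>free_group\<^esub> word_class v \<in> relators rels"
    using assms by (auto simp: relators_def)
  then have "word_class u \<otimes>\<^bsub>free_group\<^esub> inv\<^bsub>free_group\<^esub> word_class v
      \<in> normal_closure free_group (relators rels)"
    using F.normal_closure_normal(2)[OF relators_subset] by blast
  then have "word_class u \<in> normal_closure free_group (relators rels) #>\<^bsub>free_group\<^esub> word_class v"
    by (intro N.rcos_module_rev) (simp_all add: F.is_group)
  then show ?thesis
    unfolding word_eval_presented_gen
    by (rule F.repr_independence[OF _ word_class_in_carrier N.subgroup_axioms, symmetric])
qed

text \<open>The first isomorphism theorem for the evaluation map \<^term>\<open>word_eval G f\<close>, whose kernel is
  the normal closure of the relators as soon as the words it kills are trivial in the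
  presented group.\<close>

theorem presentation_iso:
  assumes G: "group G" and f: "range f \<subseteq> carrier G"
    and rel: "\<And>u v. (u, v) \<in> rels \<Longrightarrow> word_eval G f u = word_eval G f v"
    and ker: "\<And>w. word_eval G f w = \<one>\<^bsub>G\<^esub> \<Longrightarrow>
      word_eval (presented_group rels) (presented_gen rels) w = \<one>\<^bsub>presented_group rels\<^esub>"
  shows "\<exists>\<phi>. \<phi> \<in> iso (presented_group rels) (subgroup_generated G (range f)) \<and>
             (\<forall>x. \<phi> (presented_gen rels x) = f x)"
proof -
  interpret G: group G by fact
  interpret F: group free_group by (rule group_free_group)
  interpret N: normal "normal_closure free_group (relators rels)" free_group
    by (rule normal_closure_relators_normal)
  let ?N = "normal_closure free_group (relators rels)"
  let ?H = "subgroup_generated G (range f)"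
  define h where "h A = word_eval G f (SOME w. A = word_class w)" for A
  have h: "h (word_class w) = word_eval G f w" for w
  proof -
    have "word_class w = word_class (SOME v. word_class w = word_class v)"
      by (rule someI[of _ w]) simp
    then show ?thesis unfolding h_def using G.word_eval_word_class_cong[OF f] by metis
  qed
  have H: "carrier ?H = range (word_eval G f)"
    using f by (simp add: carrier_subgroup_generated Int_absorb1 G.word_eval_generate)
  have hcar: "h ` carrier free_group = carrier ?H"
    unfolding H by (auto simp: h elim!: word_class_exists) (metis h imageI word_class_in_carrier)
  have hom: "h \<in> hom free_group ?H"
  proof (rule homI)
    show "h A \<in> carrier ?H" if "A \<in> carrier free_group" for A
      using that hcar by blast
    show "h (A \<otimes>\<^bsub>free_group\<^esub> B) = h A \<otimes>\<^bsub>?H\<^esub> h B"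
      if "A \<in> carrier free_group" "B \<in> carrier free_group" for A B
      using that by (auto simp: free_group_mult h G.word_eval_append[OF f] elim!: word_class_exists)
  qed
  interpret h: group_hom free_group ?H h
    by (simp add: group_hom_def group_hom_axioms_def hom G.group_subgroup_generated F.is_group)
  have kerN: "kernel free_group ?H h = ?N"
  proof
    have "word_class u \<otimes>\<^bsub>free_group\<^esub> inv\<^bsub>free_group\<^esub> word_class v \<in> kernel free_group ?H h"
      if "(u, v) \<in> rels" for u v
    proof -
      have "h (word_class u) = h (word_class v)" using rel[OF that] by (simp add: h)
      then have "h (word_class u \<otimes>\<^bsub>free_group\<^esub> inv\<^bsub>free_group\<^esub> word_class v) = \<one>\<^bsub>?H\<^esub>"
        by (simp only: h.hom_mult h.hom_inv F.inv_closed word_class_in_carrier h.hom_closed h.H.r_inv)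
      then show ?thesis by (simp add: kernel_def)
    qed
    then have "relators rels \<subseteq> kernel free_group ?H h"
      by (auto simp: relators_def)
    then show "?N \<subseteq> kernel free_group ?H h"
      unfolding normal_closure_def using h.normal_kernel by blast
    show "kernel free_group ?H h \<subseteq> ?N"
    proof
      fix A assume A: "A \<in> kernel free_group ?H h"
      then obtain w where w: "A = word_class w"
        unfolding kernel_def by (auto elim: word_class_exists)
      then have "word_eval G f w = \<one>\<^bsub>G\<^esub>" using A by (simp add: kernel_def h)
      then have "?N #>\<^bsub>free_group\<^esub> A = ?N"
        using ker[of w] unfolding word_eval_presented_gen w by (simp add: presented_group_def FactGroup_def)
      then show "A \<in> ?N"
        using N.subgroup_axioms w F.rcos_self[of A ?N] by simp
    qed
  qed
  have "(\<lambda>A. the_elem (h ` A)) \<in> iso (presented_group rels) ?H"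
    using h.FactGroup_iso_set[OF hcar] unfolding kerN presented_group_def .
  moreover have "the_elem (h ` presented_gen rels x) = f x" for x
  proof -
    have fx: "f x \<in> carrier G" using f by auto
    \<comment> \<open>\<open>h\<close> kills \<open>?N\<close> and so is constant on each coset, as
      \<open>the_elem\<close> requires.\<close>
    have "h B = f x" if B: "B \<in> presented_gen rels x" for B
    proof -
      obtain n where n: "n \<in> ?N" "B = n \<otimes>\<^bsub>free_group\<^esub> word_class [(x, True)]"
        using B by (auto simp: presented_gen_def r_coset_def)
      then have "n \<in> carrier free_group" "h n = \<one>\<^bsub>G\<^esub>"
        using kerN by (auto simp: kernel_def)
      then show "h B = f x" using n fx by (simp add: h)
    qed
    moreover have "presented_gen rels x \<noteq> {}"
      unfolding presented_gen_def using F.rcos_self[OF word_class_in_carrier N.subgroup_axioms] by blast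
    ultimately have "h ` presented_gen rels x = {f x}" by auto
    then show ?thesis by simp
  qed
  ultimately show ?thesis by blast
qed

section \<open>Words of matrices\<close>

abbreviation mat2 :: "'b::zero \<Rightarrow> 'b \<Rightarrow> 'b \<Rightarrow> 'b \<Rightarrow> 'b^2^2" where
  "mat2 a b c d \<equiv> vector [vector [a, b], vector [c, d]]"

lemma mat2_mult:
  "mat2 a b c d ** mat2 a' b' c' d' =
     (mat2 (a*a' + b*c') (a*b' + b*d') (c*a' + d*c') (c*b' + d*d') :: 'b::comm_semiring_1^2^2)"
  by (simp add: vec_eq_iff matrix_matrix_mult_def sum_2 forall_2)

lemma mat_eq_mat2: "mat k = (mat2 k 0 0 k :: 'b::comm_semiring_1^2^2)"
  by (simp add: vec_eq_iff mat_def forall_2)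

text \<open>The cone over a subset of the affine chart \<open>(z, 1)\<close> of the projective line. On cones the
  projective action is linear, so that no denominators have to be tracked along a word.\<close>

definition chart_cone :: "complex set \<Rightarrow> (complex^2) set" where
  "chart_cone A = {v. v $ 2 \<noteq> 0 \<and> v $ 1 / v $ 2 \<in> A}"

lemma chart_cone_mono: "A \<subseteq> B \<Longrightarrow> v \<in> chart_cone A \<Longrightarrow> v \<in> chart_cone B"
  by (auto simp: chart_cone_def)

text \<open>The vector is a multiple of (z, 1); the factor cancels in the ratio of the coordinates
  of its image.\<close>

lemma chart_cone_mat2:
  assumes "\<And>z. z \<in> A \<Longrightarrow> c * z + d \<noteq> 0 \<and> (a * z + b) / (c * z + d) \<in> B"
    and "v \<in> chart_cone A"
  shows "mat2 a b c d *v v \<in> chart_cone B"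
proof -
  define z where "z = v $ 1 / v $ 2"
  have z: "z \<in> A" "v $ 2 \<noteq> 0" "v $ 1 = v $ 2 * z"
    using assms(2) by (auto simp: chart_cone_def z_def)
  have "(mat2 a b c d *v v) $ 1 = v $ 2 * (a * z + b)"
    "(mat2 a b c d *v v) $ 2 = v $ 2 * (c * z + d)"
    by (simp_all add: matrix_vector_mult_def sum_2 z(3) algebra_simps)
  then show ?thesis using assms(1)[OF z(1)] z(2) by (simp add: chart_cone_def)
qed

lemma chart_cone_scalar:
  assumes "M \<in> scalars" "M *v v \<in> chart_cone A"
  shows "v \<in> chart_cone A"
proof -
  obtain k where k: "M = mat k" "k \<noteq> 0" using assms(1) by (auto simp: scalars_def)
  have "(M *v v) $ i = k * v $ i" for i
    by (simp add: k matrix_vector_mult_def mat_def if_distrib if_distribR sum.delta cong: if_cong)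
  then show ?thesis using assms(2) k(2) by (simp add: chart_cone_def)
qed

fun letter_mat :: "int \<Rightarrow> letter \<Rightarrow> complex^2^2" where
  "letter_mat D S1 = mat2 (-1) 2 (-1) 1"
| "letter_mat D S2 = mat2 1 (-1) 2 (-1)"
| "letter_mat D S3 = mat2 0 1 (-1) 0"
| "letter_mat D Sr = mat2 1 (1 - tau D) 0 (-1)"

text \<open>Letters carry no exponents, because each generator is its own inverse up to a
  scalar.\<close>

definition list_mat :: "int \<Rightarrow> letter list \<Rightarrow> complex^2^2" where
  "list_mat D l = foldr (\<lambda>x M. letter_mat D x ** M) l (mat 1)"

lemma list_mat_Nil [simp]: "list_mat D [] = mat 1"
  and list_mat_Cons [simp]: "list_mat D (x # l) = letter_mat D x ** list_mat D l"
  by (simp_all add: list_mat_def)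

lemma list_mat_append: "list_mat D (l @ m) = list_mat D l ** list_mat D m"
  by (induction l) (simp_all add: matrix_mul_assoc)

lemma list_mat_Cons_vec: "list_mat D (x # l) *v v = letter_mat D x *v (list_mat D l *v v)"
  and list_mat_append_vec: "list_mat D (l @ m) *v v = list_mat D l *v (list_mat D m *v v)"
  by (simp_all add: list_mat_append matrix_vector_mul_assoc)

lemma invertible_letter_mat: "invertible (letter_mat D x)"
  by (cases x) (simp_all add: invertible_det_nz det_2)

lemma invertible_list_mat: "invertible (list_mat D l)"
proof (induction l)
  case Nil
  have "invertible (mat 1 :: complex^2^2)" by (auto simp: invertible_def)
  then show ?case by simp
qed (simp add: invertible_mult invertible_letter_mat)

text \<open>Modulo 3, the two congruences say that the columns are orthogonal and of equal norm;
  these matrices form the preimage in \<open>SL\<^sub>2(\<int>)\<close> of the quaternion subgroup of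
  \<open>SL\<^sub>2(\<F>\<^sub>3)\<close>.\<close>

definition conformal_mod_3 :: "int \<Rightarrow> int \<Rightarrow> int \<Rightarrow> int \<Rightarrow> bool" where
  "conformal_mod_3 a b c d \<longleftrightarrow>
     a * d - b * c = 1 \<and> 3 dvd a * b + c * d \<and> 3 dvd a\<^sup>2 + c\<^sup>2 - b\<^sup>2 - d\<^sup>2"

text \<open>The matrix M of \<open>S1\<close> satisfies M^T M = 2 I modulo 3, so left multiplication
  by M doubles the inner products of columns. The same congruence serves \<open>S2\<close>; the
  matrix of \<open>S3\<close> is orthogonal.\<close>

lemma conformal_mod_3_S1:
  assumes "conformal_mod_3 a b c d"
  shows "conformal_mod_3 (2*c - a) (2*d - b) (c - a) (d - b)"
proof -
  have "(2*c - a) * (2*d - b) + (c - a) * (d - b) = 2 * (a*b + c*d) + 3 * (c*d - a*d - b*c)"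
    "(2*c - a)\<^sup>2 + (c - a)\<^sup>2 - (2*d - b)\<^sup>2 - (d - b)\<^sup>2 =
      2 * (a\<^sup>2 + c\<^sup>2 - b\<^sup>2 - d\<^sup>2) + 3 * (c\<^sup>2 - 2*a*c - d\<^sup>2 + 2*b*d)"
    "(2*c - a) * (d - b) - (2*d - b) * (c - a) = a*d - b*c"
    by (simp_all add: algebra_simps power2_eq_square)
  from this assms show ?thesis
    unfolding conformal_mod_3_def by (simp only:) (metis dvd_add dvd_mult dvd_triv_left)
qed

lemma conformal_mod_3_S2:
  assumes "conformal_mod_3 a b c d"
  shows "conformal_mod_3 (a - c) (b - d) (2*a - c) (2*b - d)"
proof -
  have "(a - c) * (b - d) + (2*a - c) * (2*b - d) = 2 * (a*b + c*d) + 3 * (a*b - a*d - b*c)"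
    "(a - c)\<^sup>2 + (2*a - c)\<^sup>2 - (b - d)\<^sup>2 - (2*b - d)\<^sup>2 =
      2 * (a\<^sup>2 + c\<^sup>2 - b\<^sup>2 - d\<^sup>2) + 3 * (a\<^sup>2 - 2*a*c - b\<^sup>2 + 2*b*d)"
    "(a - c) * (2*b - d) - (b - d) * (2*a - c) = a*d - b*c"
    by (simp_all add: algebra_simps power2_eq_square)
  from this assms show ?thesis
    unfolding conformal_mod_3_def by (simp only:) (metis dvd_add dvd_mult dvd_triv_left)
qed

lemma conformal_mod_3_S3:
  assumes "conformal_mod_3 a b c d"
  shows "conformal_mod_3 c d (-a) (-b)"
proof -
  have "c * d + (-a) * (-b) = a*b + c*d" "c\<^sup>2 + (-a)\<^sup>2 - d\<^sup>2 - (-b)\<^sup>2 = a\<^sup>2 + c\<^sup>2 - b\<^sup>2 - d\<^sup>2"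
    "c * (-b) - d * (-a) = a*d - b*c"
    by (simp_all add: algebra_simps power2_eq_square)
  then show ?thesis using assms by (simp only: conformal_mod_3_def)
qed

lemma list_mat_conformal_mod_3:
  assumes "Sr \<notin> set l"
  obtains a b c d where "list_mat D l = mat2 (of_int a) (of_int b) (of_int c) (of_int d)"
    "conformal_mod_3 a b c d"
proof -
  have "\<exists>a b c d. list_mat D l = mat2 (of_int a) (of_int b) (of_int c) (of_int d) \<and>
      conformal_mod_3 a b c d"
    using assms
  proof (induction l)
    case Nil
    have "conformal_mod_3 1 0 0 1" by (simp add: conformal_mod_3_def)
    then show ?case by (metis list_mat_Nil mat_eq_mat2 of_int_0 of_int_1)
  next
    case (Cons x l)
    then obtain a b c d where
      l: "list_mat D l = mat2 (of_int a) (of_int b) (of_int c) (of_int d)"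
      and G: "conformal_mod_3 a b c d" by auto
    show ?case
    proof (cases x)
      case S1
      with l have "list_mat D (x # l) =
          mat2 (of_int (2*c - a)) (of_int (2*d - b)) (of_int (c - a)) (of_int (d - b))"
        by (simp add: mat2_mult)
      then show ?thesis using conformal_mod_3_S1[OF G] by blast
    next
      case S2
      with l have "list_mat D (x # l) =
          mat2 (of_int (a - c)) (of_int (b - d)) (of_int (2*a - c)) (of_int (2*b - d))"
        by (simp add: mat2_mult)
      then show ?thesis using conformal_mod_3_S2[OF G] by blast
    next
      case S3
      with l have "list_mat D (x # l) =
          mat2 (of_int c) (of_int d) (of_int (-a)) (of_int (-b))"
        by (simp add: mat2_mult)
      then show ?thesis using conformal_mod_3_S3[OF G] by blast
    qed (use Cons.prems in simp)
  qed
  then show thesis using that by blast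
qed

text \<open>The determinant leaves a = d = 1 or a = d = -1, and orthogonality of the columns then
  forces 3 to divide b. The map is the translation by b / d = 3 n.\<close>

lemma conformal_mod_3_translation:
  assumes "conformal_mod_3 a b 0 d"
  obtains n where "d = a" "a = 1 \<or> a = -1" "b = 3 * n * a"
proof -
  have ad: "a * d = 1" and dvd: "3 dvd a * b" using assms by (auto simp: conformal_mod_3_def)
  from ad have a: "(a = 1 \<and> d = 1) \<or> (a = -1 \<and> d = -1)" by (simp add: zmult_eq_1_iff)
  with dvd have "3 dvd b" by auto
  then obtain k where "b = 3 * k" by blast
  with a show thesis using that[of "k * a"] by auto
qed

section \<open>Ping-pong with an ideal triangle\<close>

lemma moebius_denom_nonzero:
  fixes c d :: real
  assumes "Im z \<noteq> 0" "c \<noteq> 0 \<or> d \<noteq> 0"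
  shows "of_real c * z + of_real d \<noteq> 0"
  using assms by (auto simp: complex_eq_iff)

lemma Im_moebius:
  fixes a b c d :: real
  assumes "a * d - b * c = 1"
  shows "Im ((of_real a * z + of_real b) / (of_real c * z + of_real d)) =
         Im z / (cmod (of_real c * z + of_real d))\<^sup>2"
proof -
  have "Im z * (a * d) - Im z * (b * c) = Im z"
    using assms by (metis mult.right_neutral right_diff_distrib)
  then show ?thesis
    by (simp add: Im_divide cmod_power2 algebra_simps)
qed

lemma moebius_int:
  fixes a b c d :: int
  assumes "a * d - b * c = 1" "Im z \<noteq> 0"
  shows "of_int c * z + of_int d \<noteq> 0"
    and "Im ((of_int a * z + of_int b) / (of_int c * z + of_int d)) > 0 \<longleftrightarrow> Im z > 0"
    and "Im ((of_int a * z + of_int b) / (of_int c * z + of_int d)) < 0 \<longleftrightarrow> Im z < 0"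
proof -
  have cd: "real_of_int c \<noteq> 0 \<or> real_of_int d \<noteq> 0" using assms(1) by auto
  show nz: "of_int c * z + of_int d \<noteq> 0"
    using moebius_denom_nonzero[OF assms(2) cd] by simp
  have "real_of_int a * real_of_int d - real_of_int b * real_of_int c = 1"
    using assms(1) by (metis of_int_1 of_int_diff of_int_mult)
  from Im_moebius[OF this, of z] nz
  show "Im ((of_int a * z + of_int b) / (of_int c * z + of_int d)) > 0 \<longleftrightarrow> Im z > 0"
    and "Im ((of_int a * z + of_int b) / (of_int c * z + of_int d)) < 0 \<longleftrightarrow> Im z < 0"
    by (simp_all add: zero_less_divide_iff divide_less_0_iff)
qed

text \<open>The three regions cut off in the upper half-plane by the ideal triangle with vertices
  \<open>0, 1, \<infinity>\<close>; \<open>\<gamma>\<^sub>1, \<gamma>\<^sub>2, \<gamma>\<^sub>3\<close> are the half-turns about points of its sides.\<close>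

fun triangle_side :: "letter \<Rightarrow> complex set" where
  "triangle_side S1 = {z. Im z > 0 \<and> Re z > 1}"
| "triangle_side S2 = {z. Im z > 0 \<and> cmod (2 * z - 1) < 1}"
| "triangle_side S3 = {z. Im z > 0 \<and> Re z < 0}"
| "triangle_side Sr = {}"

lemma triangle_side_S2_strip:
  assumes "cmod (2 * z - 1) < 1" shows "0 < Re z" "Re z < 1"
  using abs_Re_le_cmod[of "2 * z - 1"] assms by auto

text \<open>In the coordinates u = z - 1, 2 z - 1, z the maps of \<open>S1\<close>,
  \<open>S2\<close>, \<open>S3\<close> become u -> -1/u, which exchanges the sides of Re u = 0 and
  of |u| = 1. The other two regions and the point 1/2 + i inside the triangle lie across the side of
  \<open>x\<close>.\<close>

lemma triangle_side_swap:
  assumes x: "x \<noteq> Sr" "y \<noteq> x" and z: "z \<in> triangle_side y \<or> z = Complex (1/2) 1"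
  obtains a b c d :: complex where "letter_mat D x = mat2 a b c d" "c * z + d \<noteq> 0"
    "(a * z + b) / (c * z + d) \<in> triangle_side x"
proof -
  have im: "Im z > 0" using z by (cases y) auto
  show thesis
  proof (cases x)
    case S1
    have re: "Re z < 1" using z x triangle_side_S2_strip S1 by (cases y) auto
    have nz: "(-1) * z + 1 \<noteq> 0" using re by (auto simp: complex_eq_iff)
    have "((-1) * z + 2) / ((-1) * z + 1) = 1 + 1 / (1 - z)"
      using nz by (simp add: field_simps)
    moreover have "Re (1 / (1 - z)) > 0" using re by (simp add: Re_divide sum_power2_gt_zero_iff)
    moreover have "Im (((-1) * z + 2) / ((-1) * z + 1)) > 0"
      using moebius_int(2)[of "-1" 1 2 "-1" z] im by simp
    ultimately show thesis using that[of "-1" 2 "-1" 1] nz S1 by simp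
  next
    case S2
    have far: "1 < cmod (2 * z - 1)"
    proof -
      consider "Re z < 0" | "Re z > 1" | "z = Complex (1/2) 1" using z x S2 by (cases y) auto
      then show ?thesis
      proof cases
        case 3
        then have "2 * z - 1 = 2 * \<i>" by (simp add: complex_eq_iff)
        then show ?thesis by (simp add: norm_mult)
      qed (use abs_Re_le_cmod[of "2 * z - 1"] in auto)
    qed
    then have nz: "2 * z + (-1) \<noteq> 0" by auto
    have "2 * ((1 * z + (-1)) / (2 * z + (-1))) - 1 = - 1 / (2 * z - 1)"
      using nz by (simp add: field_simps)
    moreover have "1 / cmod (2 * z - 1) < 1" using far by (subst divide_less_eq_1_pos) auto
    ultimately have "cmod (2 * ((1 * z + (-1)) / (2 * z + (-1))) - 1) < 1"
      by (simp only: norm_divide norm_minus_cancel norm_one)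
    moreover have "Im ((1 * z + (-1)) / (2 * z + (-1))) > 0"
      using moebius_int(2)[of 1 "-1" "-1" 2 z] im by simp
    ultimately show thesis using that[of 1 "-1" 2 "-1"] nz S2 by simp
  next
    case S3
    have re: "Re z > 0" using z x triangle_side_S2_strip S3 by (cases y) auto
    have nz: "(-1) * z + 0 \<noteq> 0" using re by auto
    have "Re ((0 * z + 1) / ((-1) * z + 0)) < 0"
      using re by (simp add: Re_divide sum_power2_gt_zero_iff divide_less_0_iff)
    moreover have "Im ((0 * z + 1) / ((-1) * z + 0)) > 0"
      using moebius_int(2)[of 0 0 1 "-1" z] im by simp
    ultimately show thesis using that[of 0 1 "-1" 0] nz S3 by simp
  qed (use x in simp)
qed

text \<open>The entries may be chosen after z, as \<open>triangle_side_swap\<close> supplies them;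
  the cone over a single point suffices.\<close>

lemma chart_cone_matI:
  assumes "\<And>z. z \<in> A \<Longrightarrow> \<exists>a b c d. M = mat2 a b c d \<and> c * z + d \<noteq> 0 \<and>
      (a * z + b) / (c * z + d) \<in> B" and "v \<in> chart_cone A"
  shows "M *v v \<in> chart_cone B"
proof -
  let ?z = "v $ 1 / v $ 2"
  have "?z \<in> A" and v: "v \<in> chart_cone {?z}" using assms(2) by (auto simp: chart_cone_def)
  then obtain a b c d where M: "M = mat2 a b c d" "c * ?z + d \<noteq> 0"
    "(a * ?z + b) / (c * ?z + d) \<in> B"
    using assms(1) by metis
  show ?thesis unfolding M(1) by (rule chart_cone_mat2[OF _ v]) (use M in auto)
qed

text \<open>Ping-pong from the right end: each letter differs from the one before it and throws the
  region reached so far, at first the base point, into its own.\<close>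

lemma list_mat_triangle_side:
  assumes "Sr \<notin> set l" "distinct_adj l" "l \<noteq> []" and v: "v \<in> chart_cone {Complex (1/2) 1}"
  shows "list_mat D l *v v \<in> chart_cone (triangle_side (hd l))"
  using assms(1-3)
proof (induction l)
  case (Cons x l)
  have x: "x \<noteq> Sr" using Cons.prems by auto
  have base: "list_mat D l *v v \<in> chart_cone (if l = [] then {Complex (1/2) 1} else triangle_side (hd l))"
    using Cons v by (auto dest: distinct_adj_ConsD)
  have step: "\<exists>a b c d. letter_mat D x = mat2 a b c d \<and> c * z + d \<noteq> 0 \<and>
      (a * z + b) / (c * z + d) \<in> triangle_side x"
    if "z \<in> (if l = [] then {Complex (1/2) 1} else triangle_side (hd l))" for z
  proof -
    obtain y where "y \<noteq> x" "z \<in> triangle_side y \<or> z = Complex (1/2) 1"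
    proof (cases "l = []")
      case True
      \<comment> \<open>At the base point y is a dummy; it only has to differ from x.\<close>
      show thesis by (rule that[of "if x = S1 then S2 else S1"]) (use True \<open>z \<in> _\<close> in auto)
    next
      case False
      then show thesis
        using that[of "hd l"] \<open>z \<in> _\<close> Cons.prems by (auto simp: distinct_adj_Cons)
    qed
    from triangle_side_swap[OF x this, of D] show ?thesis by metis
  qed
  show ?case
    unfolding list_mat_Cons_vec list.sel by (rule chart_cone_matI[OF step base])
qed simp

text \<open>A scalar fixes the base point 1/2 + i, which lies in none of the three regions.\<close>

lemma list_mat_reduced_not_scalar:
  assumes "Sr \<notin> set l" "distinct_adj l" "l \<noteq> []"
  shows "list_mat D l \<notin> scalars"
proof
  define v :: "complex^2" where "v = vector [Complex (1/2) 1, 1]"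
  have v: "v \<in> chart_cone {Complex (1/2) 1}" by (simp add: chart_cone_def v_def)
  assume "list_mat D l \<in> scalars"
  from chart_cone_scalar[OF this list_mat_triangle_side[OF assms v]]
  have "Complex (1/2) 1 \<in> triangle_side (hd l)" using v by (simp add: chart_cone_def)
  moreover have "2 * Complex (1/2) 1 - 1 = 2 * \<i>" by (simp add: complex_eq_iff)
  ultimately show False by (cases "hd l") (auto simp: norm_mult)
qed

section \<open>Ping-pong with isometric circles\<close>

text \<open>The isometric circle |c z + d| = 1 has radius 1/|c|; the unit circles about integers are
  the largest ones, those with |c| = 1.\<close>

definition above_circles :: "complex set" where
  "above_circles = {z. Im z > 0 \<and> (\<forall>n::int. 1 < cmod (z - of_int n))}"

definition inside_circles :: "complex set" where
  "inside_circles = {z. Im z > 0 \<and> (\<exists>n::int. cmod (z - of_int n) < 1)}"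

text \<open>For |c| = 1 the quantity is itself a distance to an integer. For |c| \<ge> 2, the
  integer nearest to Re z gives (Im z)^2 \<ge> 1 - 1/4, whence |c z + d|^2 \<ge> 3. The second
  alternative transfers strict and weak bounds alike.\<close>

lemma isometric_circle_bound:
  fixes c d :: int
  assumes "\<And>n::int. 1 \<le> cmod (z - of_int n)" and c: "c \<noteq> 0"
  shows "1 < cmod (of_int c * z + of_int d) \<or> (\<exists>n::int. cmod (of_int c * z + of_int d) = cmod (z - of_int n))"
proof (cases "\<bar>c\<bar> = 1")
  case True
  then consider "c = 1" | "c = -1" by linarith
  then show ?thesis
  proof cases
    case 1
    then have "of_int c * z + of_int d = z - of_int (-d)" by simp
    then show ?thesis by metis
  next
    case 2
    then have "of_int c * z + of_int d = - (z - of_int d)" by simp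
    then show ?thesis by (metis norm_minus_cancel)
  qed
next
  case False
  with c have c2: "2 \<le> \<bar>c\<bar>" by linarith
  define n where "n = round (Re z)"
  have "\<bar>Re z - of_int n\<bar> \<le> 1/2"
    using of_int_round_abs_le[of "Re z"] by (simp add: n_def abs_minus_commute)
  then have "(Re z - of_int n)\<^sup>2 \<le> (1/2)\<^sup>2" by (rule power2_le_iff_abs_le[THEN iffD2, rotated]) simp
  moreover have "1\<^sup>2 \<le> (cmod (z - of_int n))\<^sup>2" by (rule power_mono) (use assms in auto)
  ultimately have im: "(Im z)\<^sup>2 \<ge> 3/4" by (simp add: cmod_power2 power_divide)
  have "(2::int)\<^sup>2 \<le> c\<^sup>2" using c2 power_mono[of 2 "\<bar>c\<bar>" 2] by simp
  then have "real_of_int 4 \<le> real_of_int (c\<^sup>2)" unfolding of_int_le_iff by simp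
  then have "4 * (3/4) \<le> (real_of_int c)\<^sup>2 * (Im z)\<^sup>2" using im by (intro mult_mono) auto
  also have "\<dots> \<le> (cmod (of_int c * z + of_int d))\<^sup>2" by (simp add: cmod_power2 power_mult_distrib)
  finally have "1\<^sup>2 < (cmod (of_int c * z + of_int d))\<^sup>2" by simp
  then show ?thesis using power2_less_imp_less norm_ge_zero by blast
qed

text \<open>If \<open>w\<close> is the image of \<open>z\<close>, then \<open>(a - c w) (c z + d) = 1\<close>: the isometric circles of a
  matrix and of its inverse cannot both be avoided.\<close>

lemma above_circles_moebius:
  fixes a b c d :: int
  assumes det: "a * d - b * c = 1" and c: "c \<noteq> 0" and z: "z \<in> above_circles"
  shows "(of_int a * z + of_int b) / (of_int c * z + of_int d) \<in> inside_circles"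
proof -
  define w where "w = (of_int a * z + of_int b) / (of_int c * z + of_int d)"
  have im: "Im z > 0" and far: "1 < cmod (z - of_int n)" for n
    using z by (auto simp: above_circles_def)
  have nz: "of_int c * z + of_int d \<noteq> 0" and "Im w > 0"
    using moebius_int[OF det, of z] im by (auto simp: w_def)
  have gt: "1 < cmod (of_int c * z + of_int d)"
    using isometric_circle_bound[of z c d, OF less_imp_le[OF far] c] far by auto
  have "w * (of_int c * z + of_int d) = of_int a * z + of_int b" using nz by (simp add: w_def)
  then have "(of_int (-c) * w + of_int a) * (of_int c * z + of_int d) =
      of_int (-c) * (of_int a * z + of_int b) + of_int a * (of_int c * z + of_int d)"
    by (metis distrib_right mult.assoc)
  also have "\<dots> = of_int (a * d - b * c)" by (simp add: algebra_simps)
  also have "\<dots> = 1" by (simp only: det of_int_1)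
  finally have prod: "cmod (of_int (-c) * w + of_int a) * cmod (of_int c * z + of_int d) = 1"
    by (metis norm_mult norm_one)
  have "\<exists>n::int. cmod (w - of_int n) < 1"
  proof (rule ccontr)
    assume "\<nexists>n::int. cmod (w - of_int n) < 1"
    then have far': "1 \<le> cmod (w - of_int n)" for n :: int by (simp add: not_less)
    then have "1 \<le> cmod (of_int (-c) * w + of_int a)"
      using isometric_circle_bound[of w "-c" a, OF far'] c far' by (metis less_imp_le neg_equal_0_iff_equal)
    \<comment> \<open>One strict factor suffices: z avoids the closed discs, w only the open
      ones.\<close>
    then have "1 * 1 < cmod (of_int (-c) * w + of_int a) * cmod (of_int c * z + of_int d)"
      using gt by (intro mult_le_less_imp_less) auto
    with prod show False by simp
  qed
  with \<open>Im w > 0\<close> show ?thesis by (simp add: inside_circles_def w_def)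
qed

text \<open>If 4 divides D, then D \<le> -16 and |n + \<tau>|^2 = n^2 - D/4 \<ge> 4. Otherwise it is
  ((2 n + 1)^2 - D)/4 \<ge> (1 + 15)/4.\<close>

lemma tau_bounds:
  assumes "D \<le> -15"
  shows "1 < Im (tau D)" and "2 \<le> cmod (of_int n + tau D)"
proof -
  define s where "s = sqrt (- real_of_int D)"
  have s2: "s\<^sup>2 = - real_of_int D" and "s \<ge> 0" using assms by (simp_all add: s_def)
  have D: "real_of_int D \<le> -15" using assms by linarith
  have sq: "csqrt (of_int D) = \<i> * of_real s"
    using csqrt_of_real_nonpos[of "real_of_int D"] D by (simp add: s_def)
  have im: "Im (tau D) = s / 2" by (simp add: tau_def sq)
  have "2\<^sup>2 < s\<^sup>2" using s2 D by simp
  then have "2 < s" using \<open>s \<ge> 0\<close> by (rule power2_less_imp_less)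
  then show "1 < Im (tau D)" by (simp add: im)
  have "2\<^sup>2 \<le> (cmod (of_int n + tau D))\<^sup>2"
  proof (cases "D mod 4 = 0")
    case True
    then have "D \<le> -16" using assms by presburger
    then have "real_of_int D \<le> -16" by linarith
    then have "16 \<le> s\<^sup>2" using s2 by simp
    moreover have "(cmod (of_int n + tau D))\<^sup>2 = (real_of_int n)\<^sup>2 + s\<^sup>2 / 4"
      using True by (simp add: tau_def sq cmod_power2 power_divide)
    ultimately show ?thesis
      using zero_le_power2[of "real_of_int n"] unfolding power2_eq_square[of "2::real"] by linarith
  next
    case False
    have "2 * n + 1 \<noteq> 0" by presburger
    then have "0 < (2 * n + 1)\<^sup>2" by (rule zero_less_power2[THEN iffD2])
    then have "1 \<le> (2 * n + 1)\<^sup>2" by linarith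
    then have "real_of_int 1 \<le> real_of_int ((2 * n + 1)\<^sup>2)" unfolding of_int_le_iff .
    then have "1 \<le> (2 * real_of_int n + 1)\<^sup>2" by simp
    moreover have "(cmod (of_int n + tau D))\<^sup>2 = ((2 * real_of_int n + 1)\<^sup>2 + s\<^sup>2) / 4"
    proof -
      have "Re (of_int n + tau D) = (2 * real_of_int n + 1) / 2" "Im (of_int n + tau D) = s / 2"
        using False by (simp_all add: tau_def sq add_divide_distrib)
      then show ?thesis unfolding cmod_power2 by (simp only: power_divide) (simp add: add_divide_distrib)
    qed
    ultimately show ?thesis using s2 D by simp
  qed
  then show "2 \<le> cmod (of_int n + tau D)" by (rule power2_le_imp_le) simp
qed

text \<open>For w = \<tau> - 1 - z, the sum of w - n and z - k is \<tau> plus an integer, of modulus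
  at least 2, so |z - k| < 1 forces |w - n| > 1. If Im z < 0, then Im w > 1 already.\<close>

lemma half_turn_above_circles:
  assumes D: "D \<le> -15" and z: "z \<in> inside_circles \<or> Im z < 0"
  shows "(z + (1 - tau D)) / (-1) \<in> above_circles"
proof -
  let ?w = "(z + (1 - tau D)) / (-1)"
  have im: "Im ?w = Im (tau D) - Im z" by simp
  have "0 < Im ?w \<and> 1 < cmod (?w - of_int n)" for n :: int
    using z
  proof
    assume "Im z < 0"
    then show ?thesis
      using abs_Im_le_cmod[of "?w - of_int n"] im tau_bounds(1)[OF D] by simp
  next
    assume "z \<in> inside_circles"
    then obtain k :: int where k: "cmod (z - of_int k) < 1" by (auto simp: inside_circles_def)
    have "Im z < 1" using abs_Im_le_cmod[of "z - of_int k"] k by simp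
    moreover have "2 \<le> cmod (of_int (- k - 1 - n) + tau D)" by (rule tau_bounds(2)[OF D])
    moreover have "of_int (- k - 1 - n) + tau D = (?w - of_int n) + (z - of_int k)" by simp
    ultimately have "2 \<le> cmod (?w - of_int n) + cmod (z - of_int k)"
      by (metis norm_triangle_ineq order_trans)
    then show ?thesis using k im tau_bounds(1)[OF D] \<open>Im z < 1\<close> by linarith
  qed
  then show ?thesis by (simp add: above_circles_def)
qed

text \<open>A vanishing lower left entry means that infinity is fixed. An empty \<open>g\<close> has
  the identity matrix, so adjacent \<open>Sr\<close>s are excluded too.\<close>

definition no_translation_between :: "int \<Rightarrow> letter list \<Rightarrow> bool" where
  "no_translation_between D l \<longleftrightarrow>
     (\<forall>u g w. l = u @ Sr # g @ Sr # w \<longrightarrow> Sr \<notin> set g \<longrightarrow> list_mat D g $ 2 $ 1 \<noteq> 0)"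

lemma list_mat_half_planes:
  assumes "Sr \<notin> set l"
  shows "v \<in> chart_cone {z. Im z > 0} \<Longrightarrow> list_mat D l *v v \<in> chart_cone {z. Im z > 0}"
    and "v \<in> chart_cone {z. Im z < 0} \<Longrightarrow> list_mat D l *v v \<in> chart_cone {z. Im z < 0}"
proof -
  obtain a b c d where l: "list_mat D l = mat2 (of_int a) (of_int b) (of_int c) (of_int d)"
    and G: "a * d - b * c = 1"
    using list_mat_conformal_mod_3[OF assms] by (metis conformal_mod_3_def)
  show "v \<in> chart_cone {z. Im z > 0} \<Longrightarrow> list_mat D l *v v \<in> chart_cone {z. Im z > 0}"
    unfolding l by (rule chart_cone_mat2) (use moebius_int[OF G] in auto)
  show "v \<in> chart_cone {z. Im z < 0} \<Longrightarrow> list_mat D l *v v \<in> chart_cone {z. Im z < 0}"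
    unfolding l by (rule chart_cone_mat2) (use moebius_int[OF G] in auto)
qed

lemma list_mat_inside_circles:
  assumes "Sr \<notin> set l" "list_mat D l $ 2 $ 1 \<noteq> 0" "v \<in> chart_cone above_circles"
  shows "list_mat D l *v v \<in> chart_cone inside_circles"
proof -
  obtain a b c d where l: "list_mat D l = mat2 (of_int a) (of_int b) (of_int c) (of_int d)"
    and G: "a * d - b * c = 1"
    using list_mat_conformal_mod_3[OF assms(1)] by (metis conformal_mod_3_def)
  have c: "c \<noteq> 0" using assms(2) by (simp add: l)
  have "of_int c * z + of_int d \<noteq> 0" if "z \<in> above_circles" for z
    using moebius_int(1)[OF G, of z] that by (auto simp: above_circles_def)
  then show ?thesis
    unfolding l by (intro chart_cone_mat2[OF _ assms(3)] conjI above_circles_moebius[OF G c])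
qed

text \<open>The segment after the last \<open>Sr\<close> may be a translation, hence the start in
  the lower half-plane, which every \<open>Sr\<close>-free word preserves. Afterwards each gap leads
  inside the circles and each \<open>Sr\<close> back above them.\<close>

lemma list_mat_above_circles:
  assumes D: "D \<le> -15" and v: "v \<in> chart_cone {z. Im z < 0}"
    and "no_translation_between D (Sr # l)"
  shows "list_mat D (Sr # l) *v v \<in> chart_cone above_circles"
  using assms(3)
proof (induction l rule: length_induct)
  case (1 l)
  have "list_mat D l *v v \<in> chart_cone (inside_circles \<union> {z. Im z < 0})"
  proof (cases "Sr \<in> set l")
    case False
    show ?thesis by (rule chart_cone_mono[OF _ list_mat_half_planes(2)[OF False v]]) auto
  next
    case True
    then obtain g m where l: "l = g @ Sr # m" and g: "Sr \<notin> set g" by (meson split_list_first)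
    have "Sr # l = [] @ Sr # g @ Sr # m" by (simp add: l)
    then have c: "list_mat D g $ 2 $ 1 \<noteq> 0"
      using 1(2) g unfolding no_translation_between_def by blast
    have "no_translation_between D (Sr # m)"
      unfolding no_translation_between_def
    proof (intro allI impI)
      fix u h w assume "Sr # m = u @ Sr # h @ Sr # w" "Sr \<notin> set h"
      moreover from this have "Sr # l = (Sr # g @ u) @ Sr # h @ Sr # w" by (simp add: l)
      ultimately show "list_mat D h $ 2 $ 1 \<noteq> 0"
        using 1(2) unfolding no_translation_between_def by blast
    qed
    then have "list_mat D (Sr # m) *v v \<in> chart_cone above_circles" using 1(1) l by simp
    from list_mat_inside_circles[OF g c this]
    have "list_mat D l *v v \<in> chart_cone inside_circles" unfolding l list_mat_append_vec .
    then show ?thesis by (rule chart_cone_mono[rotated]) auto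
  qed
  then show ?case
    unfolding list_mat_Cons_vec letter_mat.simps
    by (rule chart_cone_mat2[rotated]) (use half_turn_above_circles[OF D] in auto)
qed

text \<open>The segment before the first \<open>Sr\<close> preserves the upper half-plane, so the
  word carries -i from the lower to the upper half-plane.\<close>

lemma no_translation_between_not_scalar:
  assumes D: "D \<le> -15" and l: "no_translation_between D l" "Sr \<in> set l"
  shows "list_mat D l \<notin> scalars"
proof
  define v :: "complex^2" where "v = vector [- \<i>, 1]"
  have v: "v \<in> chart_cone {z. Im z < 0}" by (simp add: chart_cone_def v_def)
  obtain g m where gm: "l = g @ Sr # m" and g: "Sr \<notin> set g" using l(2) by (meson split_list_first)
  have "no_translation_between D (Sr # m)"
    unfolding no_translation_between_def
  proof (intro allI impI)
    fix u h w assume "Sr # m = u @ Sr # h @ Sr # w" "Sr \<notin> set h"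
    moreover from this have "l = (g @ u) @ Sr # h @ Sr # w" by (simp add: gm)
    ultimately show "list_mat D h $ 2 $ 1 \<noteq> 0"
      using l(1) unfolding no_translation_between_def by blast
  qed
  from list_mat_above_circles[OF D v this]
  have "list_mat D (Sr # m) *v v \<in> chart_cone {z. Im z > 0}"
    by (rule chart_cone_mono[rotated]) (auto simp: above_circles_def)
  from list_mat_half_planes(1)[OF g this]
  have "list_mat D l *v v \<in> chart_cone {z. Im z > 0}" unfolding gm list_mat_append_vec .
  moreover assume "list_mat D l \<in> scalars"
  ultimately have "v \<in> chart_cone {z. Im z > 0}" by (metis chart_cone_scalar)
  then show False by (simp add: chart_cone_def v_def)
qed

section \<open>Reduction of words\<close>

text \<open>Instantiated by \<open>PGL2\<close> and by the presented group, so that each rewriting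
  of words is valid in both.\<close>

locale relations_model = group G for G (structure) +
  fixes f :: "letter \<Rightarrow> 'a"
  assumes closed [simp]: "f x \<in> carrier G"
    and involution [simp]: "f x \<otimes> f x = \<one>"
    and Sr_reverses: "f Sr \<otimes> (f S1 \<otimes> (f S2 \<otimes> f S3)) = f S3 \<otimes> (f S2 \<otimes> (f S1 \<otimes> f Sr))"
begin

definition list_prod :: "letter list \<Rightarrow> 'a" where
  "list_prod l = foldr (\<lambda>x y. f x \<otimes> y) l \<one>"

lemma list_prod_Nil [simp]: "list_prod [] = \<one>"
  and list_prod_Cons [simp]: "list_prod (x # l) = f x \<otimes> list_prod l"
  by (simp_all add: list_prod_def)

lemma list_prod_closed [simp]: "list_prod l \<in> carrier G"
  by (induction l) simp_all

lemma list_prod_append: "list_prod (l @ m) = list_prod l \<otimes> list_prod m"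
  by (induction l) (simp_all add: m_assoc)

lemma involution_left [simp]: "y \<in> carrier G \<Longrightarrow> f x \<otimes> (f x \<otimes> y) = y"
  by (simp flip: m_assoc)

lemma list_prod_cancel: "list_prod (u @ [x, x] @ v) = list_prod (u @ v)"
  by (simp add: list_prod_append)

lemma list_prod_rev: "list_prod (rev l) = inv (list_prod l)"
proof -
  have "list_prod (rev l) \<otimes> list_prod l = \<one>"
    by (induction l) (simp_all add: list_prod_append m_assoc)
  then show ?thesis by (simp add: inv_equality)
qed

lemma word_eval_eq_list_prod: "word_eval G f w = list_prod (map fst w)"
proof (induction w)
  case (Cons a w)
  have "inv f x = f x" for x by (rule inv_equality) simp_all
  with Cons show ?case by (cases a) simp
qed simp

lemma Sr_commutation:
  "f Sr \<otimes> list_prod (concat (replicate n [S1, S2, S3])) =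
   list_prod (concat (replicate n [S3, S2, S1])) \<otimes> f Sr"
proof (induction n)
  case (Suc n)
  let ?C = "list_prod (concat (replicate n [S1, S2, S3]))"
  let ?D = "list_prod (concat (replicate n [S3, S2, S1]))"
  have "f Sr \<otimes> (f S1 \<otimes> (f S2 \<otimes> (f S3 \<otimes> ?C))) = f Sr \<otimes> (f S1 \<otimes> (f S2 \<otimes> f S3)) \<otimes> ?C"
    by (simp add: m_assoc)
  also have "\<dots> = f S3 \<otimes> (f S2 \<otimes> (f S1 \<otimes> (f Sr \<otimes> ?C)))"
    unfolding Sr_reverses by (simp add: m_assoc)
  finally show ?case by (simp add: Suc m_assoc)
qed simp

text \<open>Here \<open>l\<close> represents a power of S1 S2 S3 or of its inverse S3 S2 S1.
  Conjugation by \<open>Sr\<close> inverts it, and a word in involutions is inverted by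
  reversal.\<close>

lemma Sr_conjugation:
  assumes "list_prod (l @ concat (replicate n [S3, S2, S1])) = \<one> \<or>
           list_prod (l @ concat (replicate n [S1, S2, S3])) = \<one>"
  shows "f Sr \<otimes> (list_prod l \<otimes> f Sr) = list_prod (rev l)"
proof -
  let ?C = "list_prod (concat (replicate n [S1, S2, S3]))"
  let ?D = "list_prod (concat (replicate n [S3, S2, S1]))"
  have "rev (concat (replicate n [S1, S2, S3])) = concat (replicate n [S3, S2, S1])"
    by (simp add: rev_concat)
  then have D: "?D = inv ?C" by (metis list_prod_rev)
  have C: "f Sr \<otimes> (?C \<otimes> f Sr) = ?D"
  proof -
    have "f Sr \<otimes> (?C \<otimes> f Sr) = f Sr \<otimes> ?C \<otimes> f Sr" by (simp add: m_assoc)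
    also have "\<dots> = ?D" unfolding Sr_commutation by (simp add: m_assoc)
    finally show ?thesis .
  qed
  then have D': "f Sr \<otimes> (?D \<otimes> f Sr) = ?C" by (simp add: m_assoc flip: C)
  have "list_prod l = ?C \<or> list_prod l = ?D"
    using assms by (metis D inv_equality inv_inv list_prod_append list_prod_closed)
  then show ?thesis using C D' D by (auto simp: list_prod_rev)
qed

end

section \<open>Words in \<open>PGL2\<close> and their matrices\<close>

lemma scalars_coset_mult:
  assumes "invertible A" "invertible B"
  shows "(scalars #>\<^bsub>GL2\<^esub> A) \<otimes>\<^bsub>PGL2\<^esub> (scalars #>\<^bsub>GL2\<^esub> B) = scalars #>\<^bsub>GL2\<^esub> (A ** B)"
  using normal.rcos_sum[OF normal_scalars, of A B] assms
  by (simp add: PGL2_def FactGroup_def GL2_def)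

lemma group_PGL2: "group PGL2"
  unfolding PGL2_def by (rule normal.factorgroup_is_group[OF normal_scalars])

lemma gen_image_eq: "gen_image D x = scalars #>\<^bsub>GL2\<^esub> letter_mat D x"
  by (cases x) (simp_all add: pgl_def)

lemma scalars_coset_one: "scalars #>\<^bsub>GL2\<^esub> A = \<one>\<^bsub>PGL2\<^esub> \<longleftrightarrow> A \<in> scalars" if "invertible A"
proof -
  interpret group GL2 by (rule group_GL2)
  have "A \<in> carrier GL2" using that by (simp add: GL2_def)
  then show ?thesis
    using rcos_self[OF _ subgroup_scalars, of A] coset_join2[OF _ subgroup_scalars, of A]
    by (auto simp: PGL2_def FactGroup_def)
qed

lemma scalars_coset_eq:
  assumes "A = mat k ** B" "k \<noteq> 0" "invertible A" "invertible B"
  shows "scalars #>\<^bsub>GL2\<^esub> A = scalars #>\<^bsub>GL2\<^esub> B"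
proof -
  interpret group GL2 by (rule group_GL2)
  have "mat k \<in> scalars" using assms(2) by (auto simp: scalars_def)
  then have "A \<in> scalars #>\<^bsub>GL2\<^esub> B" by (auto simp: r_coset_def GL2_def assms(1))
  then show ?thesis
    using repr_independence[OF _ _ subgroup_scalars, of A B] assms(4) by (simp add: GL2_def)
qed

lemma list_mat_coset:
  "foldr (\<lambda>x y. gen_image D x \<otimes>\<^bsub>PGL2\<^esub> y) l \<one>\<^bsub>PGL2\<^esub> = scalars #>\<^bsub>GL2\<^esub> list_mat D l"
proof (induction l)
  case Nil
  have "invertible (mat 1 :: complex^2^2)" by (auto simp: invertible_def)
  moreover have "mat 1 \<in> scalars" by (auto simp: scalars_def)
  ultimately show ?case using scalars_coset_one[of "mat 1"] by simp
next
  case (Cons x l)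
  then show ?case
    by (simp add: gen_image_eq scalars_coset_mult invertible_letter_mat invertible_list_mat)
qed

lemma gen_image_relations_model: "relations_model PGL2 (gen_image D)"
proof -
  interpret group PGL2 by (rule group_PGL2)
  show ?thesis
  proof
    show closed: "gen_image D x \<in> carrier PGL2" for x
      using invertible_letter_mat[of D x]
      by (auto simp: gen_image_eq PGL2_def FactGroup_def RCOSETS_def GL2_def)
    show "gen_image D x \<otimes>\<^bsub>PGL2\<^esub> gen_image D x = \<one>\<^bsub>PGL2\<^esub>" for x
    proof -
      have "\<exists>k. k \<noteq> 0 \<and> letter_mat D x ** letter_mat D x = mat k"
        \<comment> \<open>The three \<gamma> matrices square to -1, that of \<open>Sr\<close> to
          1.\<close>
        by (intro exI[of _ "if x = Sr then 1 else -1"], cases x) (simp_all add: mat2_mult mat_eq_mat2)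
      then have "letter_mat D x ** letter_mat D x \<in> scalars" by (auto simp: scalars_def)
      then show ?thesis
        by (simp add: gen_image_eq scalars_coset_mult scalars_coset_one invertible_letter_mat
            invertible_mult)
    qed
    have "list_mat D [Sr, S1, S2, S3] = mat (-1) ** list_mat D [S3, S2, S1, Sr]"
      by (simp add: mat2_mult mat_eq_mat2)
    then have "scalars #>\<^bsub>GL2\<^esub> list_mat D [Sr, S1, S2, S3] =
        scalars #>\<^bsub>GL2\<^esub> list_mat D [S3, S2, S1, Sr]"
      by (rule scalars_coset_eq) (simp_all only: invertible_list_mat, simp)
    then show "gen_image D Sr \<otimes>\<^bsub>PGL2\<^esub> (gen_image D S1 \<otimes>\<^bsub>PGL2\<^esub> (gen_image D S2 \<otimes>\<^bsub>PGL2\<^esub> gen_image D S3)) =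
        gen_image D S3 \<otimes>\<^bsub>PGL2\<^esub> (gen_image D S2 \<otimes>\<^bsub>PGL2\<^esub> (gen_image D S1 \<otimes>\<^bsub>PGL2\<^esub> gen_image D Sr))"
      unfolding list_mat_coset[symmetric] using closed by (simp del: gen_image.simps)
  qed
qed

text \<open>Carries the rewriting rules of \<open>relations_model\<close> over to scalarity of
  \<open>list_mat\<close>.\<close>

lemma list_prod_gen_image_one:
  "relations_model.list_prod PGL2 (gen_image D) l = \<one>\<^bsub>PGL2\<^esub> \<longleftrightarrow> list_mat D l \<in> scalars"
  by (simp add: relations_model.list_prod_def[OF gen_image_relations_model] list_mat_coset
      scalars_coset_one invertible_list_mat)

text \<open>Each \<gamma> matrix has its negative as inverse, so S3 S2 S1 is minus the inverse of
  the translation S1 S2 S3; hence the sign.\<close>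

lemma list_mat_replicate:
  "list_mat D (concat (replicate n [S1, S2, S3])) = mat2 1 (3 * of_nat n) 0 1"
  "list_mat D (concat (replicate n [S3, S2, S1])) = mat ((-1) ^ n) ** mat2 1 (- 3 * of_nat n) 0 1"
  by (induction n) (simp_all add: mat2_mult mat_eq_mat2 algebra_simps)

text \<open>Up to sign the matrix is the translation by 3 k, which |k| copies of S3 S2 S1 or S1 S2
  S3 undo, according to the sign of k.\<close>

lemma list_mat_translation:
  assumes "Sr \<notin> set l" "list_mat D l $ 2 $ 1 = 0"
  obtains n where "list_mat D (l @ concat (replicate n [S3, S2, S1])) \<in> scalars \<or>
    list_mat D (l @ concat (replicate n [S1, S2, S3])) \<in> scalars"
proof -
  obtain a b c d where l: "list_mat D l = mat2 (of_int a) (of_int b) (of_int c) (of_int d)"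
    and G: "conformal_mod_3 a b c d"
    using list_mat_conformal_mod_3[OF assms(1)] by metis
  have "c = 0" using assms(2) by (simp add: l)
  with G obtain k where k: "d = a" "a = 1 \<or> a = -1" "b = 3 * k * a"
    using conformal_mod_3_translation by metis
  show thesis
  proof (cases "k \<ge> 0")
    case True
    have "list_mat D (l @ concat (replicate (nat k) [S3, S2, S1])) = mat ((-1) ^ nat k * of_int a)"
      unfolding list_mat_append list_mat_replicate l using True k(1,3) \<open>c = 0\<close>
      by (simp add: mat2_mult mat_eq_mat2 mult.commute)
    then show thesis using k(2) by (intro that[of "nat k"]) (auto simp: scalars_def)
  next
    case False
    have "list_mat D (l @ concat (replicate (nat (- k)) [S1, S2, S3])) = mat (of_int a)"
      unfolding list_mat_append list_mat_replicate l using False k(1,3) \<open>c = 0\<close>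
      by (simp add: mat2_mult mat_eq_mat2)
    then show thesis using k(2) by (intro that[of "nat (- k)"]) (auto simp: scalars_def)
  qed
qed

section \<open>The word problem\<close>

lemma not_distinct_adj_decomp:
  assumes "\<not> distinct_adj l"
  obtains u x v where "l = u @ [x, x] @ v"
proof -
  obtain i where i: "Suc i < length l" "l ! i = l ! Suc i"
    using assms by (auto simp: distinct_adj_conv_nth)
  have "l = take i l @ [l ! i, l ! i] @ drop (Suc (Suc i)) l"
    using i id_take_nth_drop[of i l] Cons_nth_drop_Suc[of "Suc i" l] by simp
  then show thesis using that by blast
qed

context relations_model
begin

text \<open>Cancelling a repeated letter changes neither the value in \<open>G\<close> nor scalarity
  of the matrix, and a reduced nonempty word is not scalar.\<close>

lemma list_prod_one_without_Sr:
  assumes "Sr \<notin> set l" "list_mat D l \<in> scalars"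
  shows "list_prod l = \<one>"
  using assms
proof (induction l rule: length_induct)
  case (1 l)
  interpret P: relations_model PGL2 "gen_image D" by (rule gen_image_relations_model)
  show ?case
  proof (cases "distinct_adj l")
    case True
    then show ?thesis using list_mat_reduced_not_scalar[of l D] 1(2,3) by (cases "l = []") auto
  next
    case False
    then obtain u x v where l: "l = u @ [x, x] @ v"
      by (metis not_distinct_adj_decomp)
    then have "list_mat D (u @ v) \<in> scalars"
      using 1(3) P.list_prod_cancel[of u x v] by (simp only: flip: list_prod_gen_image_one)
    with 1(1,2) have "list_prod (u @ v) = \<one>" by (simp add: l)
    then show ?thesis unfolding l by (simp only: list_prod_cancel)
  qed
qed

text \<open>The matrix of \<open>g\<close> shows that \<open>g\<close> times a power of S1 S2 S3 or
  S3 S2 S1 is scalar; by \<open>list_prod_one_without_Sr\<close> this is an identity in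
  \<open>G\<close>, to which \<open>Sr_conjugation\<close> applies.\<close>

lemma list_prod_translation:
  assumes "Sr \<notin> set g" "list_mat D g $ 2 $ 1 = 0"
  shows "list_prod (u @ Sr # g @ Sr # w) = list_prod (u @ rev g @ w)"
proof -
  obtain n where "list_mat D (g @ concat (replicate n [S3, S2, S1])) \<in> scalars \<or>
    list_mat D (g @ concat (replicate n [S1, S2, S3])) \<in> scalars"
    using list_mat_translation[OF assms] .
  moreover have "Sr \<notin> set (g @ concat (replicate n [S3, S2, S1]))"
    "Sr \<notin> set (g @ concat (replicate n [S1, S2, S3]))"
    using assms(1) by auto
  ultimately have "list_prod (g @ concat (replicate n [S3, S2, S1])) = \<one> \<or>
      list_prod (g @ concat (replicate n [S1, S2, S3])) = \<one>"
    using list_prod_one_without_Sr by blast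
  from Sr_conjugation[OF this]
  have "list_prod (Sr # g @ [Sr]) = list_prod (rev g)" by (simp add: list_prod_append)
  moreover have "u @ Sr # g @ Sr # w = u @ (Sr # g @ [Sr]) @ w" by simp
  ultimately show ?thesis by (simp only: list_prod_append)
qed

text \<open>Induction on length: a scalar word containing \<open>Sr\<close> must have a translation
  between two consecutive \<open>Sr\<close>s, and replacing that stretch by \<open>rev g\<close>
  removes two letters.\<close>

theorem list_prod_one:
  assumes D: "D \<le> -15" and "list_mat D l \<in> scalars"
  shows "list_prod l = \<one>"
  using assms(2)
proof (induction l rule: length_induct)
  case (1 l)
  interpret P: relations_model PGL2 "gen_image D" by (rule gen_image_relations_model)
  consider "Sr \<notin> set l" | "Sr \<in> set l" "no_translation_between D l"
    | "\<not> no_translation_between D l" by blast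
  then show ?case
  proof cases
    case 1
    then show ?thesis using list_prod_one_without_Sr \<open>list_mat D l \<in> scalars\<close> by blast
  next
    case 2
    then show ?thesis
      using no_translation_between_not_scalar[OF D] \<open>list_mat D l \<in> scalars\<close> by blast
  next
    case 3
    then obtain u g w where l: "l = u @ Sr # g @ Sr # w" and g: "Sr \<notin> set g" "list_mat D g $ 2 $ 1 = 0"
      unfolding no_translation_between_def by blast
    \<comment> \<open>The same replacement, made in \<open>PGL2\<close>, keeps the matrix
      scalar.\<close>
    have "list_mat D (u @ rev g @ w) \<in> scalars"
      using 1(2) P.list_prod_translation[OF g] unfolding l by (simp flip: list_prod_gen_image_one)
    with 1(1) have "list_prod (u @ rev g @ w) = \<one>" by (simp add: l)
    then show ?thesis unfolding l list_prod_translation[OF g] .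
  qed
qed

end

section \<open>The isomorphism\<close>

lemma presented_gen_relations_model:
  "relations_model (presented_group A0_relations) (presented_gen A0_relations)"
proof -
  interpret group "presented_group A0_relations" by (rule group_presented_group)
  have closed: "presented_gen A0_relations x \<in> carrier (presented_group A0_relations)" for x
    by (rule subsetD[OF presented_gen_closed rangeI])
  show ?thesis
  proof
    show "presented_gen A0_relations x \<otimes>\<^bsub>presented_group A0_relations\<^esub> presented_gen A0_relations x =
        \<one>\<^bsub>presented_group A0_relations\<^esub>" for x
    proof -
      have "([(x, True), (x, True)], []) \<in> A0_relations"
        by (cases x) (simp_all add: A0_relations_def)
      from presented_gen_relation[OF this] show ?thesis using closed by simp
    qed
    have "([(Sr, True), (S1, True), (S2, True), (S3, True)],
        [(S3, True), (S2, True), (S1, True), (Sr, True)]) \<in> A0_relations"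
      by (simp add: A0_relations_def)
    from presented_gen_relation[OF this]
    show "presented_gen A0_relations Sr \<otimes>\<^bsub>presented_group A0_relations\<^esub>
        (presented_gen A0_relations S1 \<otimes>\<^bsub>presented_group A0_relations\<^esub>
          (presented_gen A0_relations S2 \<otimes>\<^bsub>presented_group A0_relations\<^esub> presented_gen A0_relations S3)) =
        presented_gen A0_relations S3 \<otimes>\<^bsub>presented_group A0_relations\<^esub>
        (presented_gen A0_relations S2 \<otimes>\<^bsub>presented_group A0_relations\<^esub>
          (presented_gen A0_relations S1 \<otimes>\<^bsub>presented_group A0_relations\<^esub> presented_gen A0_relations Sr))"
      using closed by simp
  qed (rule closed)
qed

theorem theorem12p4:
  fixes K :: "complex set" and \<Delta> :: int
  assumes "imaginary_quadratic_field K"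
    and "has_discriminant K \<Delta>"
    and "\<Delta> \<le> -15"
  shows "\<exists>\<phi>. \<phi> \<in> iso (presented_group A0_relations) (A0 \<Delta>) \<and>
             (\<forall>x. \<phi> (presented_gen A0_relations x) = gen_image \<Delta> x)"
proof -
  interpret P: relations_model PGL2 "gen_image \<Delta>" by (rule gen_image_relations_model)
  interpret Q: relations_model "presented_group A0_relations" "presented_gen A0_relations"
    by (rule presented_gen_relations_model)
  have "range (gen_image \<Delta>) = {gen_image \<Delta> S1, gen_image \<Delta> S2, gen_image \<Delta> S3, gen_image \<Delta> Sr}"
  proof -
    have "UNIV = {S1, S2, S3, Sr}" using letter.exhaust by blast
    then show ?thesis by (metis image_empty image_insert)
  qed
  then have A0: "A0 \<Delta> = subgroup_generated PGL2 (range (gen_image \<Delta>))" by (simp add: A0_def)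
  show ?thesis
    unfolding A0
  proof (rule presentation_iso)
    show "range (gen_image \<Delta>) \<subseteq> carrier PGL2" using P.closed by auto
  next
    fix u v assume "(u, v) \<in> A0_relations"
    then show "word_eval PGL2 (gen_image \<Delta>) u = word_eval PGL2 (gen_image \<Delta>) v"
      using P.Sr_reverses by (auto simp: A0_relations_def simp del: gen_image.simps)
  next
    fix w assume "word_eval PGL2 (gen_image \<Delta>) w = \<one>\<^bsub>PGL2\<^esub>"
    then show "word_eval (presented_group A0_relations) (presented_gen A0_relations) w =
        \<one>\<^bsub>presented_group A0_relations\<^esub>"
      unfolding P.word_eval_eq_list_prod Q.word_eval_eq_list_prod list_prod_gen_image_one
      by (rule Q.list_prod_one[OF assms(3)])
  qed (rule group_PGL2)
qed

end
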